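(* Let $i,j$ be arbitrary integers and let $a,b,c$ be complex numbers such that neither $\frac{a+b+i+1}{2}$ nor $2c+j$ is zero or a negative integer, and such that the three series $f_{i,j+1}(a,b,c)$, $f_{i,j}(a,b,c)$ and $f_{i,j}(a+1,b+1,c+1)$ converge. Then $$(2c+j)\, f_{i,j+1}(a,b,c) = (2c+j)\, f_{i,j}(a,b,c)-\frac{2abc}{(a+b+i+1)(2c+j+1)}\, f_{i,j}(a+1,b+1,c+1).$$
   Context: For a complex number $\alpha$ and an integer $n\ge 0$, the shifted factorial is $(\alpha)_n=\alpha(\alpha+1)\cdots(\alpha+n-1)$ for $n\ge 1$, and $(\alpha)_0=1$. For integers $i,j$ and complex $a,b,c$, define the series $$f_{i,j}(a,b,c)={}_3F_2\left[\begin{array}{c} a,\ b,\ c\\ \frac{a+b+i+1}{2},\ 2c+j\end{array};1\right]=\sum_{n=0}^{\infty}\frac{(a)_n\,(b)_n\,(c)_n}{\left(\frac{a+b+i+1}{2}\right)_n\,(2c+j)_n}\,\frac{1}{n!},$$ whenever the denominator parameters are not zero or negative integers and the series converges. In particular, $f_{i,j}(a+1,b+1,c+1)$ has numerator parameters $a+1,b+1,c+1$ and denominator parameters $\frac{a+b+i+3}{2}$ and $2c+j+2$. *)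

theory Defs
  imports Complex_Main "HOL-Library.Nonpos_Ints"
begin

definition F32_term :: "complex \<Rightarrow> complex \<Rightarrow> complex \<Rightarrow> complex \<Rightarrow> complex \<Rightarrow> complex \<Rightarrow> nat \<Rightarrow> complex" where
  "F32_term a b c d e z n =
     (pochhammer a n * pochhammer b n * pochhammer c n) /
     (pochhammer d n * pochhammer e n) * (z ^ n / fact n)"

text \<open>\<open>f_term i j a b c\<close> is the sequence of summands and \<open>f i j a b c\<close> its sum. As usual for
  \<^const>\<open>suminf\<close>, the value of \<open>f\<close> is meaningful only if \<open>f_term i j a b c\<close> is summable and no
  denominator parameter lies in \<open>\<int>\<^sub>\<le>\<^sub>0\<close>.\<close>

definition f_term :: "int \<Rightarrow> int \<Rightarrow> complex \<Rightarrow> complex \<Rightarrow> complex \<Rightarrow> nat \<Rightarrow> complex" where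
  "f_term i j a b c = F32_term a b c ((a + b + of_int i + 1) / 2) (2 * c + of_int j) 1"

definition f :: "int \<Rightarrow> int \<Rightarrow> complex \<Rightarrow> complex \<Rightarrow> complex \<Rightarrow> complex" where
  "f i j a b c = (\<Sum>n. f_term i j a b c n)"

end

theory Submission
  imports Defs
begin

text \<open>
  The relation holds term by term. Writing \<open>e = 2c + j\<close> for the lower parameter that is raised, one has
  \<open>e / (e+1)\<^sub>n - e / (e)\<^sub>n = - e n / (e)\<^bsub>n+1\<^esub>\<close>. The factor \<open>n\<close> kills the term \<open>n = 0\<close> and turns
  \<open>1 / n!\<close> into \<open>1 / (n-1)!\<close>; after the shift \<open>n = m + 1\<close>, pulling the first factor out of each of
  the Pochhammer symbols \<open>(a)\<^bsub>m+1\<^esub>\<close>, \<open>(b)\<^bsub>m+1\<^esub>\<close>, \<open>(c)\<^bsub>m+1\<^esub>\<close>, \<open>(d)\<^bsub>m+1\<^esub>\<close> and the first two out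
  of \<open>(e)\<^bsub>m+2\<^esub>\<close> leaves the \<open>m\<close>-th term of the series in which \<open>a, b, c, d\<close> are raised by 1 and \<open>e\<close>
  by 2 (\<open>F32_term_contiguous\<close>). For \<open>d = (a+b+i+1)/2\<close> this is a term
  of \<open>f i j (a+1) (b+1) (c+1)\<close>, because raising \<open>a, b, c\<close> by 1 raises \<open>(a+b+i+1)/2\<close> by 1 and
  \<open>2c + j\<close> by 2. Summation over \<open>m\<close> finishes the proof, since the terms of index 0 are 1 in both \<open>f i (j+1) a b c\<close> and \<open>f i j a b c\<close>.
\<close>

text \<open>With \<open>P = (e+2)\<^sub>m\<close>, both fractions become multiples of \<open>1 / ((e+1) P)\<close>: directly
  \<open>(e+1)\<^bsub>m+1\<^esub> = (e+1) P\<close>, and \<open>(e+1+m) (e)\<^bsub>m+1\<^esub> = e (e+1) P\<close>. The numerators are then \<open>e\<close>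
  and \<open>e + (m+1)\<close>; dividing is legitimate as no factor of \<open>(e)\<^bsub>m+2\<^esub>\<close> vanishes.\<close>
lemma pochhammer_reciprocal_difference:
  fixes e :: complex
  assumes "e \<notin> \<int>\<^sub>\<le>\<^sub>0"
  shows "e / pochhammer (e + 1) (Suc m) =
         e / pochhammer e (Suc m) - of_nat (Suc m) / ((e + 1) * pochhammer (e + 2) m)"
proof -
  define P where "P = pochhammer (e + 2) m"
  define Q where "Q = pochhammer (e + 1) m"
  have e0: "e \<noteq> 0" using assms by auto
  have nz: "pochhammer e (Suc (Suc m)) \<noteq> 0"
    using assms by (auto simp: pochhammer_eq_0_iff simp del: pochhammer_Suc)
  have P1: "pochhammer (e + 1) (Suc m) = (e + 1) * P"
    by (simp add: pochhammer_rec P_def add.assoc)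
  have Q1: "pochhammer e (Suc m) = e * Q"
    by (simp add: pochhammer_rec Q_def)
  have PQ: "(e + 1) * P = (e + 1 + of_nat m) * Q"
    using P1 by (simp add: pochhammer_rec' Q_def)
  have "e * ((e + 1) * P) \<noteq> 0"
    using nz by (simp add: pochhammer_rec[of e "Suc m"] P1)
  then have nzP: "e + 1 \<noteq> 0" "P \<noteq> 0" and nzQ: "e + 1 + of_nat m \<noteq> 0" "Q \<noteq> 0"
    using PQ by auto
  have Qinv: "e / (e * Q) = (e + 1 + of_nat m) / ((e + 1) * P)"
    using e0 nzQ by (simp add: PQ)
  have "e / ((e + 1) * P) = e / (e * Q) - of_nat (Suc m) / ((e + 1) * P)"
    unfolding Qinv diff_divide_distrib[symmetric] by simp
  then show ?thesis
    by (simp only: P1 Q1 P_def)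
qed

text \<open>The numerator \<open>m + 1\<close> of the difference above cancels against \<open>(m+1)!\<close>. This is what lowers
  the index on the right from \<open>m + 1\<close> to \<open>m\<close>.\<close>
lemma F32_term_contiguous:
  assumes "e \<notin> \<int>\<^sub>\<le>\<^sub>0"
  shows "e * F32_term a b c d (e + 1) z (Suc m) =
         e * F32_term a b c d e z (Suc m)
         - a * b * c * z / (d * (e + 1)) * F32_term (a + 1) (b + 1) (c + 1) (d + 1) (e + 2) z m"
proof -
  define K where "K = pochhammer a (Suc m) * pochhammer b (Suc m) * pochhammer c (Suc m) /
                      pochhammer d (Suc m) * (z ^ Suc m / fact (Suc m))"
  have split: "e * F32_term a b c d x z (Suc m) = K * (e / pochhammer x (Suc m))" for x
    by (simp add: F32_term_def K_def mult_ac del: pochhammer_Suc fact_Suc power_Suc)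
  have fct: "(of_nat (Suc m) :: complex) / fact (Suc m) = 1 / fact m"
    by (simp add: fact_Suc del: of_nat_Suc)
  have "K * (of_nat (Suc m) / ((e + 1) * pochhammer (e + 2) m)) =
        pochhammer a (Suc m) * pochhammer b (Suc m) * pochhammer c (Suc m) /
        pochhammer d (Suc m) * z ^ Suc m / ((e + 1) * pochhammer (e + 2) m)
        * (of_nat (Suc m) / fact (Suc m))"
    by (simp add: K_def del: pochhammer_Suc fact_Suc power_Suc of_nat_Suc)
  also have "\<dots> = a * b * c * z / (d * (e + 1))
        * F32_term (a + 1) (b + 1) (c + 1) (d + 1) (e + 2) z m"
    unfolding fct by (simp add: F32_term_def pochhammer_rec mult_ac)
  finally show ?thesis
    unfolding split pochhammer_reciprocal_difference[OF assms] right_diff_distrib by simp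
qed

theorem mainTheorem1:
  fixes i j :: int and a b c :: complex
  assumes "(a + b + of_int i + 1) / 2 \<notin> \<int>\<^sub>\<le>\<^sub>0"
    and "2 * c + of_int j \<notin> \<int>\<^sub>\<le>\<^sub>0"
    and "summable (f_term i (j + 1) a b c)"
    and "summable (f_term i j a b c)"
    and "summable (f_term i j (a + 1) (b + 1) (c + 1))"
  shows "(2 * c + of_int j) * f i (j + 1) a b c =
         (2 * c + of_int j) * f i j a b c
         - (2 * a * b * c) / ((a + b + of_int i + 1) * (2 * c + of_int j + 1))
           * f i j (a + 1) (b + 1) (c + 1)"
proof -
  define e where "e = 2 * c + of_int j"
  define d where "d = (a + b + of_int i + 1) / 2"
  define C where "C = (2 * a * b * c) / ((a + b + of_int i + 1) * (e + 1))"
  have C: "C = a * b * c * 1 / (d * (e + 1))"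
    by (simp add: C_def d_def)
  have t1: "f_term i (j + 1) a b c = F32_term a b c d (e + 1) 1"
    by (simp add: f_term_def e_def d_def add.assoc)
  have t2: "f_term i j a b c = F32_term a b c d e 1"
    by (simp add: f_term_def e_def d_def)
  have "(a + 1 + (b + 1) + of_int i + 1) / 2 = d + 1" "2 * (c + 1) + of_int j = e + 2"
    by (simp_all add: d_def e_def field_simps)
  then have t3: "f_term i j (a + 1) (b + 1) (c + 1)
                 = F32_term (a + 1) (b + 1) (c + 1) (d + 1) (e + 2) 1"
    by (simp only: f_term_def)
  have step: "e * f_term i (j + 1) a b c (Suc m) =
              e * f_term i j a b c (Suc m) - C * f_term i j (a + 1) (b + 1) (c + 1) m" for m
    unfolding t1 t2 t3 C
    by (rule F32_term_contiguous) (use assms(2) in \<open>simp add: e_def\<close>)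
  have head: "f i k a b c = 1 + (\<Sum>m. f_term i k a b c (Suc m))"
    if "summable (f_term i k a b c)" for k
  proof -
    have "f_term i k a b c 0 = 1"
      by (simp add: f_term_def F32_term_def)
    then show ?thesis
      using suminf_split_head[OF that] by (simp add: f_def)
  qed
  have s1: "summable (\<lambda>m. f_term i (j + 1) a b c (Suc m))"
    and s2: "summable (\<lambda>m. f_term i j a b c (Suc m))"
    using assms(3,4) by (simp_all only: summable_Suc_iff)
  have "e * (\<Sum>m. f_term i (j + 1) a b c (Suc m)) =
        (\<Sum>m. e * f_term i j a b c (Suc m) - C * f_term i j (a + 1) (b + 1) (c + 1) m)"
    unfolding suminf_mult[OF s1, symmetric] step ..
  also have "\<dots> = e * (\<Sum>m. f_term i j a b c (Suc m)) - C * f i j (a + 1) (b + 1) (c + 1)"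
    unfolding f_def suminf_mult[OF s2, symmetric] suminf_mult[OF assms(5), symmetric]
    by (intro suminf_diff[symmetric] summable_mult s2 assms(5))
  finally have "e * f i (j + 1) a b c = e * f i j a b c - C * f i j (a + 1) (b + 1) (c + 1)"
    unfolding head[OF assms(3)] head[OF assms(4)] by (simp add: distrib_left)
  then show ?thesis
    by (simp only: C_def e_def)
qed

end
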